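(* Let $D\subseteq\mathbb{R}^s$, let $\mathbb{P}$ be a probability measure on $D$, and let $\mathcal{H}$ be a reproducing kernel Hilbert space of real-valued functions on $D$ with kernel $K\colon D\times D\to\mathbb{R}$, where $K$ is symmetric and strictly positive definite and the kernel mean embedding $h=\int_D K(\boldsymbol{x},\cdot)\,\mathrm{d}\mathbb{P}(\boldsymbol{x})\in\mathcal{H}$ is well defined. Let $\boldsymbol{T}=(\boldsymbol{t}_k)_{k=0}^{n-1}\in D^n$ be any point set in $D$, let $V_{\boldsymbol{T}}=\mathrm{span}(K(\boldsymbol{t}_0,\cdot),\ldots,K(\boldsymbol{t}_{n-1},\cdot))\subseteq\mathcal{H}$, and let $\boldsymbol{w}^*=(w_k^* )_{k=0}^{n-1}\in\mathbb{R}^n$ satisfy the linear system $$\sum_{\ell=0}^{n-1}K(\boldsymbol{t}_k,\boldsymbol{t}_\ell)\,w_\ell^*=h(\boldsymbol{t}_k),\qquad k=0,\ldots,n-1.$$ Then, for every $f\in\mathcal{H}$, $$|If-Q_{\boldsymbol{T}}^{\boldsymbol{w}^*}f|\le e(Q_{\boldsymbol{T}}^{\boldsymbol{w}^*},\mathcal{H})\,\mathrm{dist}_{\mathcal{H}}(f,V_{\boldsymbol{T}}),$$ where $If=\int_D f\,\mathrm{d}\mathbb{P}$, $Q_{\boldsymbol{T}}^{\boldsymbol{w}^*}f=\sum_{k=0}^{n-1}w_k^*f(\boldsymbol{t}_k)$, $e(\cdot,\mathcal{H})$ is the worst-case error in $\mathcal{H}$, and $\mathrm{dist}_{\mathcal{H}}(f,V_{\boldsymbol{T}})$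 is the distance between $f$ and $V_{\boldsymbol{T}}$ in $\mathcal{H}$.
   Context: $D\subseteq\mathbb{R}^s$, $s\in\mathbb{N}$, is equipped with its Borel $\sigma$-algebra, and $n\ge 1$ is an integer. A symmetric kernel $K$ is strictly positive definite if for all $N\in\mathbb{N}$ and pairwise distinct $\boldsymbol{x}_1,\ldots,\boldsymbol{x}_N\in D$ the Gram matrix $(K(\boldsymbol{x}_i,\boldsymbol{x}_j))_{i,j=1}^N$ is strictly positive definite. The kernel mean embedding $h=\int_D K(\boldsymbol{x},\cdot)\,\mathrm{d}\mathbb{P}(\boldsymbol{x})$ is assumed throughout to be a well-defined element of $\mathcal{H}$; it satisfies $\langle h,f\rangle_{\mathcal{H}}=\int_D f\,\mathrm{d}\mathbb{P}$ for all $f\in\mathcal{H}$ (in particular every $f\in\mathcal{H}$ is $\mathbb{P}$-integrable). For $\boldsymbol{w}=(w_k)_{k=0}^{n-1}\in\mathbb{R}^n$ (weights need not be non-negative nor sum to one), the cubature rule is $Q_{\boldsymbol{T}}^{\boldsymbol{w}}f=\sum_{k=0}^{n-1}w_kf(\boldsymbol{t}_k)$ and its worst-case error is $$e(Q_{\boldsymbol{T}}^{\boldsymbol{w}},\mathcal{H})=\sup_{\|f\|_{\mathcal{H}}=1}|If-Q_{\boldsymbol{T}}^{\boldsymbol{w}}f|.$$ The distance is $\mathrm{dist}_{\mathcal{H}}(f,V_{\boldsymbol{T}})=\inf_{v\in V_{\boldsymbol{T}}}\|f-v\|_{\mathcal{H}}$. *)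

theory Defs
  imports "HOL-Probability.Probability" "HOL-Library.Function_Algebras"
begin

instantiation "fun" :: (type, real_vector) real_vector
begin

definition scaleR_fun_def: "c *\<^sub>R f = (\<lambda>x. c *\<^sub>R f x)"

instance
  by standard (simp_all add: fun_eq_iff scaleR_fun_def algebra_simps)

end

text \<open>
  Real-valued functions on a set \<open>D\<close> are represented by total functions that vanish outside \<open>D\<close>,
  so that equality on \<open>D\<close> is equality and the pointwise operations need no restriction.
\<close>

definition section_on :: "'a set \<Rightarrow> ('a \<Rightarrow> 'a \<Rightarrow> real) \<Rightarrow> 'a \<Rightarrow> 'a \<Rightarrow> real" where
  "section_on D K x = (\<lambda>y. if y \<in> D then K x y else 0)"

definition ip_norm :: "(('a \<Rightarrow> real) \<Rightarrow> ('a \<Rightarrow> real) \<Rightarrow> real) \<Rightarrow> ('a \<Rightarrow> real) \<Rightarrow> real" where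
  "ip_norm ip f = sqrt (ip f f)"

text \<open>
  \<open>H\<close> with the inner product \<open>ip\<close> is a Hilbert space of functions on \<open>D\<close> with reproducing
  kernel \<open>K\<close>. The values of \<open>ip\<close> outside \<open>H\<close> and of \<open>K\<close> outside \<open>D \<times> D\<close> are irrelevant.
\<close>

locale rkhs =
  fixes D :: "'a set"
    and K :: "'a \<Rightarrow> 'a \<Rightarrow> real"
    and H :: "('a \<Rightarrow> real) set"
    and ip :: "('a \<Rightarrow> real) \<Rightarrow> ('a \<Rightarrow> real) \<Rightarrow> real"
  assumes vanish_outside: "\<And>f x. f \<in> H \<Longrightarrow> x \<notin> D \<Longrightarrow> f x = 0"
    and subspace: "subspace H"
    and ip_commute: "\<And>f g. f \<in> H \<Longrightarrow> g \<in> H \<Longrightarrow> ip f g = ip g f"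
    and ip_add_left:
      "\<And>f g h. f \<in> H \<Longrightarrow> g \<in> H \<Longrightarrow> h \<in> H \<Longrightarrow> ip (f + g) h = ip f h + ip g h"
    and ip_scaleR_left: "\<And>c f g. f \<in> H \<Longrightarrow> g \<in> H \<Longrightarrow> ip (c *\<^sub>R f) g = c * ip f g"
    and ip_pos: "\<And>f. f \<in> H \<Longrightarrow> f \<noteq> 0 \<Longrightarrow> 0 < ip f f"
    and complete: "\<And>F :: nat \<Rightarrow> 'a \<Rightarrow> real. range F \<subseteq> H \<Longrightarrow>
      (\<forall>e>0. \<exists>M. \<forall>i\<ge>M. \<forall>j\<ge>M. ip_norm ip (F i - F j) < e) \<Longrightarrow>
      (\<exists>f\<in>H. (\<lambda>i. ip_norm ip (F i - f)) \<longlonglongrightarrow> 0)"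
    and section_mem: "\<And>x. x \<in> D \<Longrightarrow> section_on D K x \<in> H"
    and reproducing: "\<And>f x. f \<in> H \<Longrightarrow> x \<in> D \<Longrightarrow> ip f (section_on D K x) = f x"

definition symmetric_kernel :: "'a set \<Rightarrow> ('a \<Rightarrow> 'a \<Rightarrow> real) \<Rightarrow> bool" where
  "symmetric_kernel D K \<longleftrightarrow> (\<forall>x\<in>D. \<forall>y\<in>D. K x y = K y x)"

definition strictly_pos_def_kernel :: "'a set \<Rightarrow> ('a \<Rightarrow> 'a \<Rightarrow> real) \<Rightarrow> bool" where
  "strictly_pos_def_kernel D K \<longleftrightarrow>
    (\<forall>(N::nat) x. x ` {..<N} \<subseteq> D \<and> inj_on x {..<N} \<longrightarrow>
      (\<forall>c :: nat \<Rightarrow> real. (\<exists>i<N. c i \<noteq> 0) \<longrightarrow>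
        0 < (\<Sum>i<N. \<Sum>j<N. c i * K (x i) (x j) * c j)))"

definition kernel_mean :: "'a set \<Rightarrow> ('a \<Rightarrow> 'a \<Rightarrow> real) \<Rightarrow> 'a measure \<Rightarrow> 'a \<Rightarrow> real" where
  "kernel_mean D K P = (\<lambda>y. if y \<in> D then (LINT x|P. K x y) else 0)"

text \<open>
  The integral defining the kernel mean embedding exists in \<open>H\<close> in the weak sense. Since
  \<open>f x = ip f (section_on D K x)\<close> on \<open>D\<close>, the last two conditions say that
  \<open>x \<mapsto> section_on D K x\<close> is weakly integrable with integral \<open>kernel_mean D K P\<close>.
\<close>

definition kernel_mean_well_defined ::
  "'a set \<Rightarrow> ('a \<Rightarrow> 'a \<Rightarrow> real) \<Rightarrow> ('a \<Rightarrow> real) set \<Rightarrow>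
   (('a \<Rightarrow> real) \<Rightarrow> ('a \<Rightarrow> real) \<Rightarrow> real) \<Rightarrow> 'a measure \<Rightarrow> bool" where
  "kernel_mean_well_defined D K H ip P \<longleftrightarrow>
    kernel_mean D K P \<in> H \<and>
    (\<forall>f\<in>H. integrable P f) \<and>
    (\<forall>f\<in>H. ip (kernel_mean D K P) f = (LINT x|P. f x))"

definition cubature :: "nat \<Rightarrow> (nat \<Rightarrow> 'a) \<Rightarrow> (nat \<Rightarrow> real) \<Rightarrow> ('a \<Rightarrow> real) \<Rightarrow> real" where
  "cubature n t w f = (\<Sum>k<n. w k * f (t k))"

text \<open>
  The supremum is taken in the reals: when the kernel mean embedding is well defined and \<open>H\<close> is
  not trivial, the set is nonempty and bounded above.
\<close>

definition worst_case_error ::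
  "('a \<Rightarrow> real) set \<Rightarrow> (('a \<Rightarrow> real) \<Rightarrow> ('a \<Rightarrow> real) \<Rightarrow> real) \<Rightarrow> 'a measure \<Rightarrow>
   (('a \<Rightarrow> real) \<Rightarrow> real) \<Rightarrow> real" where
  "worst_case_error H ip P Q =
    (SUP f\<in>{f \<in> H. ip_norm ip f = 1}. \<bar>(LINT x|P. f x) - Q f\<bar>)"

definition ip_dist ::
  "(('a \<Rightarrow> real) \<Rightarrow> ('a \<Rightarrow> real) \<Rightarrow> real) \<Rightarrow> ('a \<Rightarrow> real) \<Rightarrow> ('a \<Rightarrow> real) set \<Rightarrow> real" where
  "ip_dist ip f V = (INF v\<in>V. ip_norm ip (f - v))"

end

theory Submission
  imports Defs
begin

text \<open>
  The error functional is represented by \<open>g = h - (\<Sum>k. w k *\<^sub>R K(t k, \<cdot>))\<close>, and the linear system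
  says that \<open>g\<close> vanishes at every node, i.e. that \<open>g\<close> is orthogonal to \<open>V\<close>. Hence replacing \<open>f\<close> by
  \<open>f - v\<close> with \<open>v \<in> V\<close> does not change the error, which is therefore at most the worst-case error
  times the norm of \<open>f - v\<close>.
\<close>

context rkhs
begin

lemma zero_mem: "0 \<in> H"
  using subspace by (rule subspace_0)

lemma add_mem: "f \<in> H \<Longrightarrow> g \<in> H \<Longrightarrow> f + g \<in> H"
  using subspace by (rule subspace_add)

lemma diff_mem: "f \<in> H \<Longrightarrow> g \<in> H \<Longrightarrow> f - g \<in> H"
  using subspace by (rule subspace_diff)

lemma scaleR_mem: "f \<in> H \<Longrightarrow> c *\<^sub>R f \<in> H"
  using subspace by (rule subspace_scale)

lemma sum_mem: "(\<And>i. i \<in> A \<Longrightarrow> f i \<in> H) \<Longrightarrow> sum f A \<in> H"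
  using subspace by (rule subspace_sum)

lemma ip_zero_left: "f \<in> H \<Longrightarrow> ip 0 f = 0"
  using ip_scaleR_left[OF zero_mem, of f 0] by simp

lemma ip_zero_right: "f \<in> H \<Longrightarrow> ip f 0 = 0"
  using ip_commute ip_zero_left zero_mem by metis

lemma ip_diff_left:
  assumes "f \<in> H" "g \<in> H" "h \<in> H"
  shows "ip (f - g) h = ip f h - ip g h"
  using ip_add_left[of "f - g" g h] assms diff_mem by simp

lemma ip_diff_right:
  assumes "f \<in> H" "g \<in> H" "h \<in> H"
  shows "ip f (g - h) = ip f g - ip f h"
  using ip_diff_left[of g h f] assms by (simp add: ip_commute[of f] diff_mem)

lemma ip_add_right:
  assumes "f \<in> H" "g \<in> H" "h \<in> H"
  shows "ip f (g + h) = ip f g + ip f h"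
  using ip_add_left[of g h f] assms by (simp add: ip_commute[of f] add_mem)

lemma ip_scaleR_right:
  assumes "f \<in> H" "g \<in> H"
  shows "ip f (c *\<^sub>R g) = c * ip f g"
  using ip_scaleR_left[of g f c] assms by (simp add: ip_commute[of f] scaleR_mem)

lemma ip_sum_left:
  assumes "finite A" "\<And>i. i \<in> A \<Longrightarrow> f i \<in> H" "g \<in> H"
  shows "ip (sum f A) g = (\<Sum>i\<in>A. ip (f i) g)"
  using assms by (induction A rule: finite_induct) (simp_all add: ip_zero_left ip_add_left sum_mem)

lemma ip_nonneg: "f \<in> H \<Longrightarrow> 0 \<le> ip f f"
  using ip_pos[of f] ip_zero_left[OF zero_mem] by (cases "f = 0") auto

lemma ip_norm_pos: "f \<in> H \<Longrightarrow> f \<noteq> 0 \<Longrightarrow> 0 < ip_norm ip f"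
  by (simp add: ip_norm_def ip_pos)

lemma ip_norm_scaleR: "f \<in> H \<Longrightarrow> ip_norm ip (c *\<^sub>R f) = \<bar>c\<bar> * ip_norm ip f"
  by (simp add: ip_norm_def ip_scaleR_left ip_scaleR_right scaleR_mem real_sqrt_mult
      flip: mult.assoc)

lemma ip_Cauchy_Schwarz:
  assumes f: "f \<in> H" and g: "g \<in> H"
  shows "\<bar>ip f g\<bar> \<le> ip_norm ip f * ip_norm ip g"
proof (cases "g = 0")
  case True
  then show ?thesis
    using f by (simp add: ip_zero_right ip_norm_def zero_mem)
next
  case False
  \<comment> \<open>\<open>c *\<^sub>R g\<close> is the orthogonal projection of \<open>f\<close>
    onto the line through \<open>g\<close>; the inequality is the nonnegativity of the squared norm
    of the residual.\<close>
  define c where "c = ip f g / ip g g"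
  have pos: "0 < ip g g"
    using ip_pos g False by blast
  have "0 \<le> ip (f - c *\<^sub>R g) (f - c *\<^sub>R g)"
    using f g by (intro ip_nonneg diff_mem scaleR_mem)
  also have "\<dots> = ip f f - (ip f g)\<^sup>2 / ip g g"
    using f g pos ip_commute[of g f]
    by (simp add: ip_diff_left ip_diff_right ip_scaleR_left ip_scaleR_right diff_mem scaleR_mem
        c_def power2_eq_square)
  finally have "(ip f g)\<^sup>2 \<le> ip f f * ip g g"
    using pos by (simp add: field_simps)
  then have "sqrt ((ip f g)\<^sup>2) \<le> sqrt (ip f f * ip g g)"
    by (rule real_sqrt_le_mono)
  then show ?thesis
    by (simp add: ip_norm_def real_sqrt_mult)
qed

text \<open>Normalising \<open>u\<close> puts it on the unit sphere, over which the supremum is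
  taken. Cauchy-Schwarz bounds the set of values by the norm of \<open>g\<close>, so the real-valued
  \<open>SUP\<close> is a genuine upper bound.\<close>

lemma abs_ip_le_SUP:
  assumes g: "g \<in> H" and u: "u \<in> H"
  shows "\<bar>ip g u\<bar> \<le> (SUP f\<in>{f \<in> H. ip_norm ip f = 1}. \<bar>ip g f\<bar>) * ip_norm ip u"
proof (cases "u = 0")
  case True
  then show ?thesis
    using g by (simp add: ip_zero_right ip_norm_def zero_mem)
next
  case False
  let ?u = "(1 / ip_norm ip u) *\<^sub>R u"
  have pos: "0 < ip_norm ip u"
    using u False by (rule ip_norm_pos)
  have "bdd_above ((\<lambda>f. \<bar>ip g f\<bar>) ` {f \<in> H. ip_norm ip f = 1})"
    using ip_Cauchy_Schwarz[OF g] by (intro bdd_aboveI[where M = "ip_norm ip g"]) fastforce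
  moreover have "?u \<in> {f \<in> H. ip_norm ip f = 1}"
    using u pos by (simp add: scaleR_mem ip_norm_scaleR)
  ultimately have "\<bar>ip g ?u\<bar> \<le> (SUP f\<in>{f \<in> H. ip_norm ip f = 1}. \<bar>ip g f\<bar>)"
    by (rule cSUP_upper[rotated])
  then show ?thesis
    using g u pos by (simp add: ip_scaleR_right abs_mult field_simps)
qed

text \<open>The vectors orthogonal to \<open>g\<close> form a subspace, so orthogonality passes from
  \<open>S\<close> to its span, and \<open>ip g f = ip g (f - v)\<close> for every \<open>v\<close>
  in the span. The previous bound applied to \<open>f - v\<close> then leaves only the infimum over
  \<open>v\<close> to be taken.\<close>

lemma abs_ip_le_dist:
  assumes g: "g \<in> H" and f: "f \<in> H" and "S \<subseteq> H"
    and orth: "\<And>v. v \<in> S \<Longrightarrow> ip g v = 0"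
    and nontrivial: "H \<noteq> {0}"
  shows "\<bar>ip g f\<bar> \<le> (SUP u\<in>{u \<in> H. ip_norm ip u = 1}. \<bar>ip g u\<bar>) * ip_dist ip f (span S)"
    (is "_ \<le> ?e * _")
proof -
  have "subspace {v \<in> H. ip g v = 0}"
    using g by (auto simp: subspace_def zero_mem add_mem scaleR_mem
        ip_zero_right ip_add_right ip_scaleR_right)
  then have span: "span S \<subseteq> {v \<in> H. ip g v = 0}"
    using \<open>S \<subseteq> H\<close> orth by (intro span_minimal) auto
  have le: "\<bar>ip g f\<bar> \<le> ?e * ip_norm ip (f - v)" if "v \<in> span S" for v
    using abs_ip_le_SUP[OF g, of "f - v"] that span f g by (auto simp: ip_diff_right diff_mem)
  \<comment> \<open>A nonzero vector makes the unit sphere nonempty. In the trivial space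
    \<open>?e\<close> would be a supremum over the empty set, whose sign is not determined.\<close>
  obtain u where u: "u \<in> H" "u \<noteq> 0"
    using nontrivial zero_mem by blast
  have "0 \<le> ?e * ip_norm ip u"
    using abs_ip_le_SUP[OF g u(1)] by linarith
  then have "0 \<le> ?e"
    using ip_norm_pos[OF u] by (simp add: zero_le_mult_iff)
  have nonempty: "span S \<noteq> {}"
    using span_zero by blast
  show ?thesis
  \<comment> \<open>For positive \<open>?e\<close>, division turns \<open>le\<close> into a lower
    bound on all the norms, hence on their infimum. For \<open>?e = 0\<close> the choice
    \<open>v = 0\<close> already gives \<open>ip g f = 0\<close>.\<close>
  proof (cases "?e = 0")
    case True
    then show ?thesis
      using le[OF span_zero] by simp
  next
    case False
    with \<open>0 \<le> ?e\<close> have pos: "0 < ?e"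
      by simp
    have "\<bar>ip g f\<bar> / ?e \<le> ip_dist ip f (span S)"
      unfolding ip_dist_def
      using nonempty le pos by (intro cINF_greatest) (auto simp: field_simps)
    then show ?thesis
      using pos by (simp add: field_simps)
  qed
qed

end

theorem proposition1:
  fixes D :: "(real ^ 's) set"
    and P :: "(real ^ 's) measure"
    and K :: "real ^ 's \<Rightarrow> real ^ 's \<Rightarrow> real"
    and H :: "(real ^ 's \<Rightarrow> real) set"
    and ip :: "(real ^ 's \<Rightarrow> real) \<Rightarrow> (real ^ 's \<Rightarrow> real) \<Rightarrow> real"
    and n :: nat
    and t :: "nat \<Rightarrow> real ^ 's"
    and w :: "nat \<Rightarrow> real"
    and f :: "real ^ 's \<Rightarrow> real"
  assumes "prob_space P"
    and "sets P = sets (restrict_space borel D)"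
    and "rkhs D K H ip"
    and "symmetric_kernel D K"
    and "strictly_pos_def_kernel D K"
    and "kernel_mean_well_defined D K H ip P"
    and "n \<ge> 1"
    and "\<And>k. k < n \<Longrightarrow> t k \<in> D"
    and "\<And>k. k < n \<Longrightarrow> (\<Sum>l<n. K (t k) (t l) * w l) = kernel_mean D K P (t k)"
    and "f \<in> H"
  shows "\<bar>(LINT x|P. f x) - cubature n t w f\<bar>
    \<le> worst_case_error H ip P (cubature n t w)
      * ip_dist ip f (span ((\<lambda>k. section_on D K (t k)) ` {..<n}))"
proof -
  interpret rkhs D K H ip
    by fact
  let ?h = "kernel_mean D K P"
  let ?k = "\<lambda>k. section_on D K (t k)"
  define g where "g = ?h - (\<Sum>k<n. w k *\<^sub>R ?k k)"
  have h: "?h \<in> H" and ip_h: "\<And>u. u \<in> H \<Longrightarrow> ip ?h u = (LINT x|P. u x)"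
    using assms(6) by (auto simp: kernel_mean_well_defined_def)
  have k: "?k k \<in> H" if "k < n" for k
    using assms(8) that by (simp add: section_mem)
  have Q: "(\<Sum>k<n. w k *\<^sub>R ?k k) \<in> H"
    using k by (auto intro: sum_mem scaleR_mem)
  have g: "g \<in> H"
    using h Q by (simp add: g_def diff_mem)
  have ip_k: "ip (?k k) u = u (t k)" if "u \<in> H" "k < n" for u k
    using that assms(8) ip_commute[OF k] reproducing by metis
  have ip_g: "ip g u = (LINT x|P. u x) - cubature n t w u" if u: "u \<in> H" for u
  proof -
    have "ip (\<Sum>k<n. w k *\<^sub>R ?k k) u = (\<Sum>k<n. ip (w k *\<^sub>R ?k k) u)"
      using k u by (intro ip_sum_left) (auto intro: scaleR_mem)
    also have "\<dots> = cubature n t w u"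
      unfolding cubature_def using k u by (intro sum.cong) (auto simp: ip_scaleR_left ip_k)
    finally show ?thesis
      using h Q u by (simp add: g_def ip_diff_left ip_h)
  qed
  have orth: "ip g (?k k) = 0" if "k < n" for k
  proof -
    \<comment> \<open>Applying the rule to the section at \<open>t k\<close> yields the left side of
      row \<open>k\<close> of the linear system. The right side is the value of \<open>?h\<close> at
      \<open>t k\<close>, which the reproducing property turns into \<open>ip ?h (?k k)\<close>, the
      integral of that section. So the rule is exact on each section.\<close>
    have "cubature n t w (?k k) = (\<Sum>l<n. K (t k) (t l) * w l)"
      unfolding cubature_def using assms(8) by (intro sum.cong) (auto simp: section_on_def)
    also have "\<dots> = ip ?h (?k k)"
      using assms(8,9) that h by (simp add: reproducing)
    finally show ?thesis
      using ip_g[OF k] ip_h[OF k] that by simp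
  qed
  \<comment> \<open>The Gram matrix of the single point \<open>t 0\<close>, which exists as
    \<open>n\<close> is at least 1, is positive. Hence the section at \<open>t 0\<close> is a
    nonzero element and \<open>H\<close> is nontrivial, as \<open>abs_ip_le_dist\<close>
    requires.\<close>
  have "0 < K (t 0) (t 0)"
    using assms(5)[unfolded strictly_pos_def_kernel_def, rule_format, of t 1 "\<lambda>_. 1"] assms(7,8)
    by (auto simp: lessThan_Suc)
  then have "?k 0 (t 0) \<noteq> 0"
    using assms(7,8) by (simp add: section_on_def)
  then have "H \<noteq> {0}"
    using k[of 0] assms(7) by (auto simp: zero_fun_def)
  moreover have "worst_case_error H ip P (cubature n t w)
      = (SUP u\<in>{u \<in> H. ip_norm ip u = 1}. \<bar>ip g u\<bar>)"
    unfolding worst_case_error_def by (intro SUP_cong) (auto simp: ip_g)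
  ultimately show ?thesis
    using abs_ip_le_dist[OF g assms(10), of "?k ` {..<n}"] k orth ip_g[OF assms(10)] by auto
qed

end
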